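(* Let $A\in\mathbb{R}^{N\times N}$ satisfy the standing assumptions in the context, let $\Delta t>0$, and let $g:\mathbb{R}^N_{>0}\to\mathbb{R}^N_{>0}$, $y^{n+1}=g(y^n)$, be the map generating the MPDeC iterates (with $M$ subintervals and $K$ corrections) applied to $y'=Ay$, as defined in the context. Let $y^*\in\ker(A)\cap\mathbb{R}^N_{>0}$ be a steady state, and write $B=\operatorname{diag}(y^* )A^T(\operatorname{diag}(y^* ))^{-1}$. Then $g\in\mathcal{C}^2$, and the Jacobian of $g$ at $y^*$ is given by $$Dg(y^* )=D^*_n y^{M,(K)},$$ $$D^*_n y^{m,(k)}=-\left(D^*_{m,(k)}\Phi^m_k\right)^{-1}\left(D^*_n\Phi^m_k+(1-\delta_{k1})\sum_{r=1}^M D^*_{r,(k-1)}\Phi^m_k\,D^*_n y^{r,(k-1)}\right)$$ for $m=1,\dots,M$ and $k=1,\dots,K$, where $\delta_{ij}$ is the Kronecker delta, $$D^*_n\Phi^m_k=\begin{cases}-\left(I+\Delta t\,(A+B)\sum_{r=0}^M\theta^m_{r,-}\right), & k=1,\\[2pt] -(I+\theta^m_0\Delta t\,A), & k>1,\end{cases}$$ and $$D^*_{l,(s)}\Phi^m_k=\begin{cases}-\theta^m_l\Delta t\,A, & s=k-1>0,\ 0<l\ne m,\\[2pt] \sum_{r=0}^M\theta^m_{r,+}\Delta t\,A-\sum_{r=0}^M\theta^m_{r,-}\Delta t\,B-\theta^m_m\Delta t\,A, & s=k-1>0,\ l=m,\\[2pt] I-\sum_{r=0}^M\theta^m_{r,+}\Delta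 t\,A+\sum_{r=0}^M\theta^m_{r,-}\Delta t\,B, & s=k,\ l=m.\end{cases}$$
   Context: $\operatorname{diag}(v)$ is the diagonal matrix with diagonal $v$, and $I$ is the identity matrix. Standing assumptions on $A=(a_{ij})\in\mathbb{R}^{N\times N}$: $A\ne 0$; all off-diagonal entries are nonnegative; $(1,\dots,1)^T\in\ker(A^T)$; the eigenvalue $0$ has equal algebraic and geometric multiplicity $k\ge1$; every eigenvalue $\lambda$ of $A$ satisfies $\operatorname{Re}(\lambda)\le 0$. Correction weights: fix integers $M,K\ge 1$ and nodes $0=t^0<t^1<\dots<t^M=1$. Let $\varphi_0,\dots,\varphi_M$ be the Lagrange basis polynomials for these nodes, $\theta^m_r=\int_0^{t^m}\varphi_r(t)\,dt$, and $\theta^m_{r,+}=\max\{0,\theta^m_r\}$, $\theta^m_{r,-}=\min\{0,\theta^m_r\}$, so $\theta^m_r=\theta^m_{r,+}+\theta^m_{r,-}$. MPDeC scheme applied to $y'=Ay$ (viewed as a production-destruction system with $p_{ij}(y)=d_{ji}(y)=a_{ij}y_j$ for $i\ne j$, $p_{ii}=d_{ii}=0$): given $y^n\in\mathbb{R}^N_{>0}$, set $y^{0,(k)}=y^n$ for all $k=0,\dots,K$ and $y^{s,(0)}=y^n$ for all $s=0,\dots,M$. For $k=1,\dots,K$ and $m=1,\dots,M$, the vector $y^{m,(k)}$ is the solution of the linear system $\Phi^m_k=0$, where $$\Phi^m_k(y^n,y^{1,(k-1)},\dots,y^{M,(k-1)},y^{m,(k)})=y^{m,(k)}-y^n-\sum_{r=0}^M\theta^m_{r,+}\Delta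 t\,P^{m,r,(k)}-\sum_{r=0}^M\theta^m_{r,-}\Delta t\,Q^{m,r,(k)},$$ $$P^{m,r,(k)}=A\operatorname{diag}(y^{m,(k)})\left(\operatorname{diag}(y^{m,(k-1)})\right)^{-1}y^{r,(k-1)},$$ $$Q^{m,r,(k)}_i=\frac{y^{m,(k)}_i}{y^{m,(k-1)}_i}\sum_{j\ne i}a_{ij}y^{r,(k-1)}_j-y^{r,(k-1)}_i\sum_{j\ne i}a_{ji}\frac{y^{m,(k)}_j}{y^{m,(k-1)}_j},\qquad i=1,\dots,N.$$ The step map is $g(y^n)=y^{n+1}=y^{M,(K)}$. For $k=1$ all $y^{r,(0)}$ equal $y^n$, so $\Phi^m_1$ is regarded as a function of $(y^n,y^{m,(1)})$ only; for $k>1$, $y^{0,(k-1)}=y^n$ and $\Phi^m_k$ is regarded as a function of the independent vector variables $y^n,y^{1,(k-1)},\dots,y^{M,(k-1)},y^{m,(k)}$. Jacobian notation: $D^*_n\Phi^m_k$ is the Jacobian of $\Phi^m_k$ with respect to the variable $y^n$, and $D^*_{l,(s)}\Phi^m_k$ the Jacobian with respect to the variable $y^{l,(s)}$, both evaluated with all vector variables equal to $y^*$ (the scheme satisfies $y^{m,(k)}(y^* )=y^*$). $D^*_n y^{m,(k)}$ is the Jacobian of the map $y^n\mapsto y^{m,(k)}(y^n)$ evaluated at $y^n=y^*$. *)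

theory Defs
  imports "HOL-Analysis.Analysis" "HOL-Computational_Algebra.Polynomial"
begin

definition diag :: "real ^ 'n \<Rightarrow> real ^ 'n ^ 'n" where
  "diag v = (\<chi> i j. if i = j then v $ i else 0)"

definition pos_orthant :: "(real ^ 'n) set" where
  "pos_orthant = {y. \<forall>i. 0 < y $ i}"

definition char_polynomial :: "real ^ 'n ^ 'n \<Rightarrow> real poly" where
  "char_polynomial A = det (\<chi> i j. (if i = j then [:0, 1:] else 0) - [:A $ i $ j:])"

definition alg_mult :: "real ^ 'n ^ 'n \<Rightarrow> real \<Rightarrow> nat" where
  "alg_mult A l = order l (char_polynomial A)"

definition geom_mult :: "real ^ 'n ^ 'n \<Rightarrow> real \<Rightarrow> nat" where
  "geom_mult A l = dim {v. A *v v = l *\<^sub>R v}"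

definition complex_eigenvalue :: "real ^ 'n ^ 'n \<Rightarrow> complex \<Rightarrow> bool" where
  "complex_eigenvalue A l \<longleftrightarrow>
     (\<exists>v :: complex ^ 'n. v \<noteq> 0 \<and> (\<chi> i j. complex_of_real (A $ i $ j)) *v v = l *s v)"

text \<open>Twice continuously differentiable, through iterated Frechet derivatives; meant for open \<open>S\<close>.\<close>

definition C2_on :: "'a::real_normed_vector set \<Rightarrow> ('a \<Rightarrow> 'b::real_normed_vector) \<Rightarrow> bool" where
  "C2_on S f \<longleftrightarrow>
     (\<exists>(f' :: 'a \<Rightarrow> 'a \<Rightarrow>\<^sub>L 'b) (f'' :: 'a \<Rightarrow> 'a \<Rightarrow>\<^sub>L 'a \<Rightarrow>\<^sub>L 'b).
        (\<forall>x\<in>S. (f has_derivative blinfun_apply (f' x)) (at x)) \<and>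
        (\<forall>x\<in>S. (f' has_derivative blinfun_apply (f'' x)) (at x)) \<and>
        continuous_on S f'')"

definition lagrange_basis :: "(nat \<Rightarrow> real) \<Rightarrow> nat \<Rightarrow> nat \<Rightarrow> real \<Rightarrow> real" where
  "lagrange_basis t M r x = (\<Prod>j\<in>{0..M} - {r}. (x - t j) / (t r - t j))"

definition theta :: "(nat \<Rightarrow> real) \<Rightarrow> nat \<Rightarrow> nat \<Rightarrow> nat \<Rightarrow> real" where
  "theta t M m r = integral {0..t m} (lagrange_basis t M r)"

definition theta_pos :: "(nat \<Rightarrow> real) \<Rightarrow> nat \<Rightarrow> nat \<Rightarrow> nat \<Rightarrow> real" where
  "theta_pos t M m r = max 0 (theta t M m r)"

definition theta_neg :: "(nat \<Rightarrow> real) \<Rightarrow> nat \<Rightarrow> nat \<Rightarrow> nat \<Rightarrow> real" where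
  "theta_neg t M m r = min 0 (theta t M m r)"

text \<open>In the next three definitions, \<open>w r\<close> is the iterate of the previous correction at node \<open>r\<close>
  and \<open>z\<close> is the vector that the current correction at node \<open>m\<close> solves for.\<close>

definition mpdec_P ::
  "real ^ 'n ^ 'n \<Rightarrow> nat \<Rightarrow> nat \<Rightarrow> (nat \<Rightarrow> real ^ 'n) \<Rightarrow> real ^ 'n \<Rightarrow> real ^ 'n" where
  "mpdec_P A m r w z = (A ** diag z ** matrix_inv (diag (w m))) *v w r"

definition mpdec_Q ::
  "real ^ 'n ^ 'n \<Rightarrow> nat \<Rightarrow> nat \<Rightarrow> (nat \<Rightarrow> real ^ 'n) \<Rightarrow> real ^ 'n \<Rightarrow> real ^ 'n" where
  "mpdec_Q A m r w z = (\<chi> i.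
     z $ i / w m $ i * (\<Sum>j\<in>UNIV - {i}. A $ i $ j * w r $ j)
     - w r $ i * (\<Sum>j\<in>UNIV - {i}. A $ j $ i * (z $ j / w m $ j)))"

definition mpdec_residual ::
  "real ^ 'n ^ 'n \<Rightarrow> real \<Rightarrow> (nat \<Rightarrow> real) \<Rightarrow> nat \<Rightarrow> nat \<Rightarrow>
   real ^ 'n \<Rightarrow> (nat \<Rightarrow> real ^ 'n) \<Rightarrow> real ^ 'n \<Rightarrow> real ^ 'n" where
  "mpdec_residual A dt t M m yn w z =
     z - yn
     - (\<Sum>r=0..M. (theta_pos t M m r * dt) *\<^sub>R mpdec_P A m r w z)
     - (\<Sum>r=0..M. (theta_neg t M m r * dt) *\<^sub>R mpdec_Q A m r w z)"

text \<open>\<open>mpdec_Phi A dt t M m k yn Y\<close> is \<open>\<Phi>\<^sup>m\<^sub>k\<close>, where \<open>Y l s\<close> is the value of the variable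
  \<open>y\<^sup>l\<^sup>,\<^sup>(\<^sup>s\<^sup>)\<close>. Only the entries that are independent variables of \<open>\<Phi>\<^sup>m\<^sub>k\<close> are read: the vectors
  \<open>y\<^sup>r\<^sup>,\<^sup>(\<^sup>0\<^sup>)\<close> (all \<open>r\<close>) and \<open>y\<^sup>0\<^sup>,\<^sup>(\<^sup>s\<^sup>)\<close> (all \<open>s\<close>) are identified with \<open>yn\<close>.\<close>

definition mpdec_Phi ::
  "real ^ 'n ^ 'n \<Rightarrow> real \<Rightarrow> (nat \<Rightarrow> real) \<Rightarrow> nat \<Rightarrow> nat \<Rightarrow> nat \<Rightarrow>
   real ^ 'n \<Rightarrow> (nat \<Rightarrow> nat \<Rightarrow> real ^ 'n) \<Rightarrow> real ^ 'n" where
  "mpdec_Phi A dt t M m k yn Y =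
     mpdec_residual A dt t M m yn
       (\<lambda>r. if k = 1 \<or> r = 0 then yn else Y r (k - 1)) (Y m k)"

text \<open>\<open>\<Phi>\<^sup>m\<^sub>k\<close> as a function of the single variable \<open>yn\<close>, respectively of the single variable
  \<open>y\<^sup>l\<^sup>,\<^sup>(\<^sup>s\<^sup>)\<close>, all other variables being fixed at \<open>ys\<close>.\<close>

definition mpdec_Phi_in_yn ::
  "real ^ 'n ^ 'n \<Rightarrow> real \<Rightarrow> (nat \<Rightarrow> real) \<Rightarrow> nat \<Rightarrow> real ^ 'n \<Rightarrow> nat \<Rightarrow> nat \<Rightarrow>
   real ^ 'n \<Rightarrow> real ^ 'n" where
  "mpdec_Phi_in_yn A dt t M ys m k x = mpdec_Phi A dt t M m k x (\<lambda>i j. ys)"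

definition mpdec_Phi_in_y ::
  "real ^ 'n ^ 'n \<Rightarrow> real \<Rightarrow> (nat \<Rightarrow> real) \<Rightarrow> nat \<Rightarrow> real ^ 'n \<Rightarrow> nat \<Rightarrow> nat \<Rightarrow>
   nat \<Rightarrow> nat \<Rightarrow> real ^ 'n \<Rightarrow> real ^ 'n" where
  "mpdec_Phi_in_y A dt t M ys m k l s x =
     mpdec_Phi A dt t M m k ys (\<lambda>i j. if i = l \<and> j = s then x else ys)"

text \<open>\<open>mpdec_iterates A dt t M k yn m\<close> is \<open>y\<^sup>m\<^sup>,\<^sup>(\<^sup>k\<^sup>)\<close> for the initial value \<open>yn\<close>.\<close>

primrec mpdec_iterates ::
  "real ^ 'n ^ 'n \<Rightarrow> real \<Rightarrow> (nat \<Rightarrow> real) \<Rightarrow> nat \<Rightarrow> nat \<Rightarrow> real ^ 'n \<Rightarrow> nat \<Rightarrow> real ^ 'n" where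
  "mpdec_iterates A dt t M 0 yn = (\<lambda>m. yn)"
| "mpdec_iterates A dt t M (Suc k) yn =
     (\<lambda>m. if m = 0 then yn
           else (THE z. mpdec_residual A dt t M m yn (mpdec_iterates A dt t M k yn) z = 0))"

definition mpdec_step ::
  "real ^ 'n ^ 'n \<Rightarrow> real \<Rightarrow> (nat \<Rightarrow> real) \<Rightarrow> nat \<Rightarrow> nat \<Rightarrow> real ^ 'n \<Rightarrow> real ^ 'n" where
  "mpdec_step A dt t M K yn = mpdec_iterates A dt t M K yn M"

end

theory Submission
  imports Defs
begin

text \<open>
  For positive arguments the residual \<open>\<Phi>\<^sup>m\<^sub>k\<close> is affine in the vector it is solved for:
  it equals \<open>S z - y\<^sup>n\<close> with a matrix \<open>S\<close> (\<open>mpdec_matrix\<close>) built from the previous correction.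
  The Patankar weights are arranged such that the off-diagonal entries of \<open>S\<close> are nonpositive, whatever
  the sign of a quadrature weight; mass conservation makes every column sum of \<open>S\<close> equal to \<open>1\<close>.
  Such a matrix is invertible with nonnegative inverse, so every stage is solvable, uniquely and with a
  positive solution, and by induction on the corrections the scheme is well defined on the positive
  orthant (\<open>mpdec_iterates_solve\<close>).

  Regularity follows from Cramer's rule: the entries of \<open>S\<close> are rational in the entries of the
  previous correction, with denominators that do not vanish on the positive orthant, and \<open>det S\<close> does
  not vanish either. Hence all components of all iterates stay in the algebra of \<open>C\<^sup>n\<close> functions
  (\<open>mpdec_iterates_Ck_on\<close>).

  All the Jacobians come from a single computation. Let the vector variables of \<open>\<Phi>\<^sup>m\<^sub>k\<close> depend
  differentiably on a parameter and take the common value \<open>y\<^sup>*\<close> at one point. There the quotients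
  \<open>z\<^sub>j / w\<^sub>j\<close> are \<open>1\<close>, \<open>A y\<^sup>* = 0\<close> and \<open>A\<^sup>T 1 = 0\<close>, so that most terms of the product rule vanish and a
  combination of \<open>A\<close> and \<open>B\<close> remains (\<open>has_derivative_mpdec_residual\<close>). Varying one variable alone
  gives the partial Jacobians. Inserting the iterates themselves, for which the residual is
  identically zero, gives the linear equation that determines the Jacobian of the next iterate
  (\<open>implicit_jacobian\<close>). Its coefficient matrix is \<open>S\<close> at the steady state, hence invertible.
\<close>

section \<open>Continuously differentiable functions and Cramer's rule\<close>

text \<open>
  The recursion goes through the partial derivatives, which are again real functions. Closure
  under the arithmetic operations is then one induction for each operation, without
  iterated spaces of linear maps.
\<close>

primrec Ck_on :: "nat \<Rightarrow> 'a::euclidean_space set \<Rightarrow> ('a \<Rightarrow> real) \<Rightarrow> bool" where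
  "Ck_on 0 S f \<longleftrightarrow> continuous_on S f"
| "Ck_on (Suc n) S f \<longleftrightarrow>
     (\<exists>D. (\<forall>x\<in>S. (f has_derivative (\<lambda>h. \<Sum>b\<in>Basis. D b x * (h \<bullet> b))) (at x)) \<and>
          (\<forall>b\<in>Basis. Ck_on n S (D b)))"

lemma Ck_on_SucI:
  assumes "\<And>x. x \<in> S \<Longrightarrow> (f has_derivative (\<lambda>h. \<Sum>b\<in>Basis. D b x * (h \<bullet> b))) (at x)"
    and "\<And>b. b \<in> Basis \<Longrightarrow> Ck_on n S (D b)"
  shows "Ck_on (Suc n) S f"
  using assms by auto

lemma Ck_on_SucD: "Ck_on (Suc n) S f \<Longrightarrow> Ck_on n S f"
proof (induction n arbitrary: f)
  case 0
  then show ?case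
    by (auto intro!: continuous_at_imp_continuous_on dest: has_derivative_continuous)
next
  case (Suc n)
  then obtain D where D: "\<forall>x\<in>S. (f has_derivative (\<lambda>h. \<Sum>b\<in>Basis. D b x * (h \<bullet> b))) (at x)"
    "\<forall>b\<in>Basis. Ck_on (Suc n) S (D b)"
    by auto
  then show ?case
    using Suc.IH by (intro Ck_on_SucI[of S f D]) blast+
qed

lemma Ck_on_cong:
  assumes "open S" "Ck_on n S f" "\<And>x. x \<in> S \<Longrightarrow> f x = g x"
  shows "Ck_on n S g"
proof (cases n)
  case 0
  then show ?thesis
    using assms continuous_on_cong[of S S f g] by auto
next
  case (Suc k)
  then show ?thesis
    using assms by (auto intro: has_derivative_transform_within_open)
qed

lemma Ck_on_const: "Ck_on n S (\<lambda>x. c)"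
proof (induction n arbitrary: c)
  case 0
  then show ?case by simp
next
  case (Suc n)
  show ?case
    by (rule Ck_on_SucI[where D = "\<lambda>b x. 0"]) (use Suc in auto)
qed

lemma Ck_on_inner: "Ck_on n S (\<lambda>x. x \<bullet> c)"
proof (cases n)
  case (Suc k)
  have "((\<lambda>x. x \<bullet> c) has_derivative (\<lambda>h. \<Sum>b\<in>Basis. (c \<bullet> b) * (h \<bullet> b))) (at x)" for x
    by (auto intro!: derivative_eq_intros simp: euclidean_inner[of _ c] mult.commute)
  then show ?thesis
    unfolding Suc by (intro Ck_on_SucI[where D = "\<lambda>b x. c \<bullet> b"]) (auto intro: Ck_on_const)
qed (auto intro: continuous_intros)

lemma Ck_on_add:
  assumes "Ck_on n S f" "Ck_on n S g"
  shows "Ck_on n S (\<lambda>x. f x + g x)"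
  using assms
proof (induction n arbitrary: f g)
  case 0
  then show ?case by (auto intro: continuous_intros)
next
  case (Suc n)
  then obtain D E where
    "\<forall>x\<in>S. (f has_derivative (\<lambda>h. \<Sum>b\<in>Basis. D b x * (h \<bullet> b))) (at x)"
    "\<forall>x\<in>S. (g has_derivative (\<lambda>h. \<Sum>b\<in>Basis. E b x * (h \<bullet> b))) (at x)"
    "\<forall>b\<in>Basis. Ck_on n S (D b)" "\<forall>b\<in>Basis. Ck_on n S (E b)"
    by auto
  then show ?case
    using Suc.IH
    by (intro Ck_on_SucI[where D = "\<lambda>b x. D b x + E b x"])
       (auto intro!: derivative_eq_intros simp: ring_distribs sum.distrib)
qed

lemma Ck_on_mult:
  assumes "Ck_on n S f" "Ck_on n S g"
  shows "Ck_on n S (\<lambda>x. f x * g x)"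
  using assms
proof (induction n arbitrary: f g)
  case 0
  then show ?case by (auto intro: continuous_intros)
next
  case (Suc n)
  then obtain D E where
    DE: "\<forall>x\<in>S. (f has_derivative (\<lambda>h. \<Sum>b\<in>Basis. D b x * (h \<bullet> b))) (at x)"
    "\<forall>x\<in>S. (g has_derivative (\<lambda>h. \<Sum>b\<in>Basis. E b x * (h \<bullet> b))) (at x)"
    "\<forall>b\<in>Basis. Ck_on n S (D b)" "\<forall>b\<in>Basis. Ck_on n S (E b)"
    by auto
  have "Ck_on n S f" "Ck_on n S g"
    using Suc.prems by (auto intro: Ck_on_SucD simp del: Ck_on.simps)
  with DE show ?case
    using Suc.IH
    by (intro Ck_on_SucI[where D = "\<lambda>b x. f x * E b x + D b x * g x"])
       (auto intro!: derivative_eq_intros Ck_on_add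
         simp: ring_distribs sum.distrib sum_distrib_left sum_distrib_right mult_ac)
qed

lemma Ck_on_inverse:
  assumes "Ck_on n S f" "\<And>x. x \<in> S \<Longrightarrow> f x \<noteq> 0"
  shows "Ck_on n S (\<lambda>x. inverse (f x))"
  using assms
proof (induction n arbitrary: f)
  case 0
  then show ?case by (auto intro: continuous_intros)
next
  case (Suc n)
  then obtain D where
    D: "\<forall>x\<in>S. (f has_derivative (\<lambda>h. \<Sum>b\<in>Basis. D b x * (h \<bullet> b))) (at x)"
    "\<forall>b\<in>Basis. Ck_on n S (D b)"
    by auto
  have "Ck_on n S (\<lambda>x. inverse (f x))"
    using Suc.prems by (intro Suc.IH) (auto intro: Ck_on_SucD simp del: Ck_on.simps)
  (* The sign is written as a constant factor, so that closure under products covers it. *)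
  with D have "Ck_on n S (\<lambda>x. (- 1 * D b x) * (inverse (f x) * inverse (f x)))" if "b \<in> Basis" for b
    using that by (intro Ck_on_mult Ck_on_const) auto
  then show ?case
    using D Suc.prems
    by (intro Ck_on_SucI[where D = "\<lambda>b x. (- 1 * D b x) * (inverse (f x) * inverse (f x))"])
       (auto intro!: derivative_eq_intros
         simp: sum_distrib_left sum_distrib_right sum_negf mult_ac)
qed

lemma Ck_on_diff: "Ck_on n S f \<Longrightarrow> Ck_on n S g \<Longrightarrow> Ck_on n S (\<lambda>x. f x - g x)"
  using Ck_on_add[OF _ Ck_on_mult[OF Ck_on_const[of n S "-1"]], of f g] by simp

lemma Ck_on_divide:
  "Ck_on n S f \<Longrightarrow> Ck_on n S g \<Longrightarrow> (\<And>x. x \<in> S \<Longrightarrow> g x \<noteq> 0) \<Longrightarrow> Ck_on n S (\<lambda>x. f x / g x)"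
  unfolding divide_inverse by (intro Ck_on_mult Ck_on_inverse)

lemma Ck_on_sum: "(\<And>i. i \<in> I \<Longrightarrow> Ck_on n S (f i)) \<Longrightarrow> Ck_on n S (\<lambda>x. \<Sum>i\<in>I. f i x)"
  by (induction I rule: infinite_finite_induct) (auto intro: Ck_on_const Ck_on_add)

lemma Ck_on_prod: "(\<And>i. i \<in> I \<Longrightarrow> Ck_on n S (f i)) \<Longrightarrow> Ck_on n S (\<lambda>x. \<Prod>i\<in>I. f i x)"
  by (induction I rule: infinite_finite_induct) (auto intro: Ck_on_const Ck_on_mult)

lemma Ck_on_if:
  "(c \<Longrightarrow> Ck_on n S f) \<Longrightarrow> (\<not> c \<Longrightarrow> Ck_on n S g) \<Longrightarrow> Ck_on n S (\<lambda>x. if c then f x else g x)"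
  by (cases c) auto

lemma Ck_on_det:
  fixes F :: "'a::euclidean_space \<Rightarrow> real ^ 'n ^ 'n"
  assumes "\<And>i j. Ck_on n S (\<lambda>x. F x $ i $ j)"
  shows "Ck_on n S (\<lambda>x. det (F x))"
  unfolding det_def by (intro Ck_on_sum Ck_on_mult Ck_on_prod Ck_on_const assms)

text \<open>
  The solution of a linear system is as smooth as its data, since it is a quotient of determinants.
\<close>

lemma Ck_on_Cramer:
  fixes F :: "'a::euclidean_space \<Rightarrow> real ^ 'n ^ 'n"
  assumes "open S"
    and F: "\<And>i j. Ck_on n S (\<lambda>x. F x $ i $ j)" and b: "\<And>i. Ck_on n S (\<lambda>x. b x $ i)"
    and det: "\<And>x. x \<in> S \<Longrightarrow> det (F x) \<noteq> 0"
    and z: "\<And>x. x \<in> S \<Longrightarrow> F x *v z x = b x"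
  shows "Ck_on n S (\<lambda>x. z x $ k)"
proof (rule Ck_on_cong[OF \<open>open S\<close>])
  let ?F = "\<lambda>x. \<chi> i j. if j = k then b x $ i else F x $ i $ j"
  show "det (?F x) / det (F x) = z x $ k" if "x \<in> S" for x
    using z[OF that] unfolding cramer[OF det[OF that]] by (simp add: vec_eq_iff)
  have "Ck_on n S (\<lambda>x. ?F x $ i $ j)" for i j
    using F b by (cases "j = k") auto
  then show "Ck_on n S (\<lambda>x. det (?F x) / det (F x))"
    by (intro Ck_on_divide Ck_on_det F det)
qed

text \<open>
  These rank-one maps are the basis in which a derivative has the partial derivatives as coefficients.
\<close>

definition partial_blinfun :: "'a::euclidean_space \<Rightarrow> 'b::real_normed_vector \<Rightarrow> 'a \<Rightarrow>\<^sub>L 'b" where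
  "partial_blinfun b c = blinfun_scaleR_left c o\<^sub>L blinfun_inner_left b"

lemma partial_blinfun_apply: "partial_blinfun b c h = (h \<bullet> b) *\<^sub>R c"
  by (simp add: partial_blinfun_def)

text \<open>
  The derivative is again a finite sum of real functions times constant vectors, now of the space of
  bounded linear maps. The lemma therefore applies to its own result, which yields the second
  derivative.
\<close>

lemma has_derivative_sum_scaleR_Ck:
  fixes f :: "'i \<Rightarrow> 'a::euclidean_space \<Rightarrow> real" and c :: "'i \<Rightarrow> 'b::real_normed_vector"
  assumes "finite I"
    and "\<And>i. i \<in> I \<Longrightarrow> (f i has_derivative (\<lambda>h. \<Sum>b\<in>Basis. D i b x * (h \<bullet> b))) (at x)"
  shows "((\<lambda>x. \<Sum>i\<in>I. f i x *\<^sub>R c i) has_derivative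
           blinfun_apply (\<Sum>(i, b)\<in>I \<times> Basis. D i b x *\<^sub>R partial_blinfun b (c i))) (at x)"
proof -
  have "blinfun_apply (\<Sum>(i, b)\<in>I \<times> Basis. D i b x *\<^sub>R partial_blinfun b (c i)) =
      (\<lambda>h. \<Sum>i\<in>I. (\<Sum>b\<in>Basis. D i b x * (h \<bullet> b)) *\<^sub>R c i)"
    using assms(1)
    by (simp add: fun_eq_iff blinfun.sum_left blinfun.scaleR_left case_prod_unfold
        sum.cartesian_product scaleR_left.sum partial_blinfun_apply)
  then show ?thesis
    using assms by (auto intro!: derivative_eq_intros)
qed

lemma C2_on_if_Ck_on:
  fixes F :: "'a::euclidean_space \<Rightarrow> real ^ 'n"
  assumes "\<And>k. Ck_on 2 S (\<lambda>x. F x $ k)"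
  shows "C2_on S F"
proof -
  have "\<forall>k. \<exists>D. (\<forall>x\<in>S. ((\<lambda>x. F x $ k) has_derivative (\<lambda>h. \<Sum>b\<in>Basis. D b x * (h \<bullet> b))) (at x)) \<and>
          (\<forall>b\<in>Basis. Ck_on 1 S (D b))"
    using assms by (simp add: numeral_2_eq_2)
  then obtain D where
    D: "\<And>k x. x \<in> S \<Longrightarrow>
        ((\<lambda>x. F x $ k) has_derivative (\<lambda>h. \<Sum>b\<in>Basis. D k b x * (h \<bullet> b))) (at x)" and
    "\<And>k b. b \<in> Basis \<Longrightarrow> Ck_on 1 S (D k b)"
    by metis
  then have "\<forall>i\<in>UNIV \<times> Basis. \<exists>E.
      (\<forall>x\<in>S. (case_prod D i has_derivative (\<lambda>h. \<Sum>b\<in>Basis. E b x * (h \<bullet> b))) (at x)) \<and>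
      (\<forall>b\<in>Basis. continuous_on S (E b))"
    by auto
  from bchoice[OF this] obtain E where
    E: "\<And>i x. i \<in> UNIV \<times> Basis \<Longrightarrow> x \<in> S \<Longrightarrow>
        (case_prod D i has_derivative (\<lambda>h. \<Sum>b\<in>Basis. E i b x * (h \<bullet> b))) (at x)" and
    cont: "\<And>i b. i \<in> UNIV \<times> Basis \<Longrightarrow> b \<in> Basis \<Longrightarrow> continuous_on S (E i b)"
    by blast
  define c :: "'n \<times> 'a \<Rightarrow> 'a \<Rightarrow>\<^sub>L (real ^ 'n)"
    where "c = (\<lambda>(k, b). partial_blinfun b (axis k 1))"
  define F' where "F' x = (\<Sum>i\<in>UNIV \<times> Basis. case_prod D i x *\<^sub>R c i)" for x
  define F'' where
    "F'' x = (\<Sum>(i, b)\<in>(UNIV \<times> Basis) \<times> Basis. E i b x *\<^sub>R partial_blinfun b (c i))" for x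
  have F: "(\<Sum>k\<in>UNIV. F x $ k *\<^sub>R axis k 1) = F x" for x
    by (simp add: basis_expansion flip: scalar_mult_eq_scaleR)
  have "(F has_derivative blinfun_apply (F' x)) (at x)" if "x \<in> S" for x
  proof -
    have "((\<lambda>x. \<Sum>k\<in>UNIV. F x $ k *\<^sub>R axis k (1 :: real)) has_derivative
        blinfun_apply (\<Sum>(k, b)\<in>UNIV \<times> Basis. D k b x *\<^sub>R partial_blinfun b (axis k 1))) (at x)"
      using D[OF that] by (intro has_derivative_sum_scaleR_Ck) auto
    then show ?thesis
      by (simp add: F F'_def c_def case_prod_unfold)
  qed
  moreover have "(F' has_derivative blinfun_apply (F'' x)) (at x)" if "x \<in> S" for x
    unfolding F'_def F''_def using E[OF _ that] by (intro has_derivative_sum_scaleR_Ck) auto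
  moreover have "continuous_on S F''"
    unfolding F''_def case_prod_unfold by (intro continuous_intros cont) auto
  ultimately show ?thesis
    unfolding C2_on_def by blast
qed

section \<open>Matrices with nonpositive off-diagonal entries and unit column sums\<close>

text \<open>
  Sum the equations over the set \<open>J\<close> of indices where \<open>z\<close> is negative. A column in \<open>J\<close> contributes
  at most \<open>z\<^sub>j\<close>, because its entries outside \<open>J\<close> are nonpositive and its entries in \<open>J\<close> thus
  add up to at least \<open>1\<close>; any other column contributes at most \<open>0\<close>. Since the total is nonnegative,
  \<open>J\<close> is empty.
\<close>

lemma monotone_matrix_if_col_sums_1:
  fixes S :: "real ^ 'n ^ 'n"
  assumes off: "\<And>i j. i \<noteq> j \<Longrightarrow> S $ i $ j \<le> 0" and col: "\<And>j. (\<Sum>i\<in>UNIV. S $ i $ j) = 1"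
    and nonneg: "\<And>i. 0 \<le> (S *v z) $ i"
  shows "0 \<le> z $ k"
proof -
  define J where "J = {j. z $ j < 0}"
  have "(\<Sum>i\<in>J. S $ i $ j) * z $ j \<le> min 0 (z $ j)" for j
  proof (cases "j \<in> J")
    case True
    have "(\<Sum>i\<in>-J. S $ i $ j) \<le> 0"
      using True by (intro sum_nonpos off) auto
    moreover have "(\<Sum>i\<in>J. S $ i $ j) + (\<Sum>i\<in>-J. S $ i $ j) = 1"
      using col[of j] sum.subset_diff[of J UNIV "\<lambda>i. S $ i $ j"] by (simp add: Compl_eq_Diff_UNIV)
    ultimately have "1 \<le> (\<Sum>i\<in>J. S $ i $ j)"
      by linarith
    then show ?thesis
      using True mult_right_mono_neg[of 1 _ "z $ j"] by (simp add: J_def)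
  next
    case False
    then have "(\<Sum>i\<in>J. S $ i $ j) \<le> 0"
      by (intro sum_nonpos off) auto
    then show ?thesis
      using False by (simp add: J_def mult_nonpos_nonneg)
  qed
  then have "(\<Sum>j\<in>UNIV. (\<Sum>i\<in>J. S $ i $ j) * z $ j) \<le> (\<Sum>j\<in>UNIV. min 0 (z $ j))"
    by (rule sum_mono)
  moreover have "(\<Sum>j\<in>UNIV. (\<Sum>i\<in>J. S $ i $ j) * z $ j) = (\<Sum>i\<in>J. (S *v z) $ i)"
    by (simp add: matrix_vector_mult_def sum_distrib_right sum.swap[of _ J])
  moreover have "0 \<le> (\<Sum>i\<in>J. (S *v z) $ i)"
    by (intro sum_nonneg nonneg)
  ultimately have "0 \<le> (\<Sum>j\<in>UNIV. min 0 (z $ j))"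
    by linarith
  moreover have "(\<Sum>j\<in>UNIV. min 0 (z $ j)) \<le> min 0 (z $ k)"
    using sum_nonpos[of "UNIV - {k}" "\<lambda>j. min 0 (z $ j)"]
    by (subst sum.remove[of _ k]) auto
  ultimately show ?thesis
    by linarith
qed

lemma det_nonzero_if_col_sums_1:
  fixes S :: "real ^ 'n ^ 'n"
  assumes "\<And>i j. i \<noteq> j \<Longrightarrow> S $ i $ j \<le> 0" "\<And>j. (\<Sum>i\<in>UNIV. S $ i $ j) = 1"
  shows "det S \<noteq> 0"
proof -
  have "z = 0" if "S *v z = 0" for z
  proof -
    have "S *v (- z) = 0"
      using that linear_neg[OF matrix_vector_mul_linear, of S z] by simp
    then have "0 \<le> z $ k" "0 \<le> (- z) $ k" for k
      using monotone_matrix_if_col_sums_1[OF assms, of z k]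
        monotone_matrix_if_col_sums_1[OF assms, of "- z" k] that by simp_all
    then show ?thesis
      by (simp add: vec_eq_iff antisym)
  qed
  then show ?thesis
    by (simp add: invertible_left_inverse matrix_left_invertible_ker flip: invertible_det_nz)
qed

text \<open>
  If a component of the nonnegative solution vanished, only the nonpositive off-diagonal terms would
  remain in that row, against a positive right-hand side.
\<close>

lemma solution_positive_if_col_sums_1:
  fixes S :: "real ^ 'n ^ 'n"
  assumes off: "\<And>i j. i \<noteq> j \<Longrightarrow> S $ i $ j \<le> 0" and "\<And>j. (\<Sum>i\<in>UNIV. S $ i $ j) = 1"
    and pos: "S *v z \<in> pos_orthant"
  shows "z \<in> pos_orthant"
proof -
  have nonneg: "0 \<le> z $ k" for k
    by (rule monotone_matrix_if_col_sums_1[OF assms(1,2)])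
      (use pos in \<open>simp_all add: pos_orthant_def less_imp_le\<close>)
  have "z $ k \<noteq> 0" for k
  proof
    assume "z $ k = 0"
    then have "S $ k $ j * z $ j \<le> 0" for j
      using off[of k j] nonneg[of j] by (cases "j = k") (auto simp: mult_nonpos_nonneg)
    then have "(S *v z) $ k \<le> 0"
      by (simp add: matrix_vector_mult_def sum_nonpos)
    then show False
      using pos by (simp add: pos_orthant_def not_less[symmetric])
  qed
  then show ?thesis
    using nonneg by (simp add: pos_orthant_def less_le)
qed

section \<open>Diagonal and inverse matrices\<close>

lemma pos_orthant_nonzero: "v \<in> pos_orthant \<Longrightarrow> v $ i \<noteq> 0"
  by (auto simp: pos_orthant_def dest: spec[of _ i])

lemma open_pos_orthant: "open (pos_orthant :: (real ^ 'n) set)"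
  using open_vector_box[of "\<lambda>i::'n. {0::real<..}"] by (simp add: pos_orthant_def)

lemma diag_matrix_mult: "(diag v ** X) $ i $ j = v $ i * X $ i $ j"
  by (simp add: matrix_matrix_mult_def diag_def mult_delta_left)

lemma matrix_mult_diag: "(X ** diag v) $ i $ j = X $ i $ j * v $ j"
  by (simp add: matrix_matrix_mult_def diag_def mult_delta_right)

lemma diag_vector_mult: "(diag v *v x) $ i = v $ i * x $ i"
  by (simp add: matrix_vector_mult_def diag_def mult_delta_left)

lemma matrix_inv_left: "invertible A \<Longrightarrow> matrix_inv A ** A = mat 1"
  unfolding invertible_def matrix_inv_def by (rule someI2_ex) simp_all

lemma solve_linear_matrix_equation:
  fixes D :: "'a::field ^ 'n ^ 'n"
  assumes "invertible D" "D ** X + R = 0"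
  shows "X = - (matrix_inv D ** R)"
proof -
  have "matrix_inv D ** (D ** X + R) = 0"
    unfolding assms(2) by simp
  then have "X + matrix_inv D ** R = 0"
    by (simp add: matrix_add_ldistrib matrix_mul_assoc matrix_inv_left[OF assms(1)])
  then show ?thesis
    by (simp add: eq_neg_iff_add_eq_0)
qed

lemma matrix_inv_diag:
  fixes v :: "real ^ 'n"
  assumes "\<And>i. v $ i \<noteq> 0"
  shows "matrix_inv (diag v) = diag (\<chi> i. 1 / v $ i)"
proof -
  have inv: "diag v ** diag (\<chi> i. 1 / v $ i) = mat 1" "diag (\<chi> i. 1 / v $ i) ** diag v = mat 1"
    unfolding vec_eq_iff diag_matrix_mult using assms by (simp_all add: diag_def mat_def)
  then have "invertible (diag v)"
    unfolding invertible_def by blast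
  then have "matrix_inv (diag v) ** diag v = mat 1"
    by (rule matrix_inv_left)
  then show ?thesis
    using inv(1) by (metis matrix_mul_assoc matrix_mul_lid matrix_mul_rid)
qed

section \<open>The linear systems of the scheme\<close>

lemma matrix_vector_mult_sum_left:
  fixes F :: "'i \<Rightarrow> real ^ 'n ^ 'm"
  shows "(\<Sum>r\<in>I. F r) *v z = (\<Sum>r\<in>I. F r *v z)"
  by (induction I rule: infinite_finite_induct) (auto simp: matrix_vector_mult_add_rdistrib)

text \<open>
  The production term is \<open>P z\<close> and the destruction term is \<open>Q z\<close> for the following two matrices
  \<open>P\<close> and \<open>Q\<close>. Here \<open>u\<close> is the previous iterate at the current node, the Patankar denominator, and
  \<open>v\<close> is the previous iterate at the quadrature node.
\<close>

definition production_matrix :: "real ^ 'n ^ 'n \<Rightarrow> real ^ 'n \<Rightarrow> real ^ 'n \<Rightarrow> real ^ 'n ^ 'n" where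
  "production_matrix A u v = (\<chi> i j. A $ i $ j * (v $ j / u $ j))"

definition destruction_matrix :: "real ^ 'n ^ 'n \<Rightarrow> real ^ 'n \<Rightarrow> real ^ 'n \<Rightarrow> real ^ 'n ^ 'n" where
  "destruction_matrix A u v =
     (\<chi> i j. (if i = j then (A *v v) $ i / u $ j else 0) - v $ i * A $ j $ i / u $ j)"

lemma mpdec_P_component:
  assumes "w m \<in> pos_orthant"
  shows "mpdec_P A m r w z $ i = (\<Sum>j\<in>UNIV. A $ i $ j * (z $ j / w m $ j * w r $ j))"
proof -
  have "w m $ j \<noteq> 0" for j
    using assms by (rule pos_orthant_nonzero)
  then have "mpdec_P A m r w z = A *v (diag z *v (diag (\<chi> i. 1 / w m $ i) *v w r))"
    by (simp add: mpdec_P_def matrix_inv_diag matrix_vector_mul_assoc matrix_mul_assoc)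
  then show ?thesis
    by (simp add: matrix_vector_mult_def[of A] diag_vector_mult)
qed

text \<open>
  The summands \<open>j = i\<close> left out of both sums of the definition cancel each other, so the sums
  may run over all indices; this turns them into products with \<open>A\<close> and \<open>A\<^sup>T\<close>.
\<close>

lemma mpdec_Q_component:
  "mpdec_Q A m r w z $ i =
     z $ i / w m $ i * (A *v w r) $ i - w r $ i * (\<Sum>j\<in>UNIV. A $ j $ i * (z $ j / w m $ j))"
  by (simp add: mpdec_Q_def matrix_vector_mult_def sum.remove[of UNIV i] algebra_simps)

lemma mpdec_P_conv_production_matrix:
  "w m \<in> pos_orthant \<Longrightarrow> mpdec_P A m r w z = production_matrix A (w m) (w r) *v z"
  by (simp add: vec_eq_iff mpdec_P_component production_matrix_def matrix_vector_mult_def mult_ac)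

lemma mpdec_Q_conv_destruction_matrix:
  "mpdec_Q A m r w z = destruction_matrix A (w m) (w r) *v z"
proof -
  have "destruction_matrix A (w m) (w r) $ i $ j * z $ j =
      (if i = j then (A *v w r) $ i / w m $ j * z $ j else 0) - w r $ i * (A $ j $ i * (z $ j / w m $ j))"
    for i j
    by (simp add: destruction_matrix_def left_diff_distrib)
  then show ?thesis
    by (simp add: vec_eq_iff mpdec_Q_component matrix_vector_mult_def[of "destruction_matrix _ _ _"]
        sum_subtractf sum_distrib_left)
qed

definition mpdec_matrix ::
  "real ^ 'n ^ 'n \<Rightarrow> real \<Rightarrow> (nat \<Rightarrow> real) \<Rightarrow> nat \<Rightarrow> nat \<Rightarrow> (nat \<Rightarrow> real ^ 'n) \<Rightarrow> real ^ 'n ^ 'n"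
  where
  "mpdec_matrix A dt t M m w =
     mat 1 - (\<Sum>r=0..M. (theta_pos t M m r * dt) *\<^sub>R production_matrix A (w m) (w r))
           - (\<Sum>r=0..M. (theta_neg t M m r * dt) *\<^sub>R destruction_matrix A (w m) (w r))"

lemma mpdec_residual_affine:
  assumes "w m \<in> pos_orthant"
  shows "mpdec_residual A dt t M m yn w z = mpdec_matrix A dt t M m w *v z - yn"
  using assms
  by (simp add: mpdec_residual_def mpdec_matrix_def mpdec_P_conv_production_matrix
      mpdec_Q_conv_destruction_matrix matrix_vector_mult_diff_rdistrib
      matrix_vector_mult_sum_left scaleR_matrix_vector_assoc)

lemma theta_pos_nonneg: "0 \<le> theta_pos t M m r" and theta_neg_nonpos: "theta_neg t M m r \<le> 0"
  by (simp_all add: theta_pos_def theta_neg_def)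

lemma theta_pos_plus_neg: "theta_pos t M m r + theta_neg t M m r = theta t M m r"
  by (simp add: theta_pos_def theta_neg_def)

locale conservative_metzler =
  fixes A :: "real ^ 'n ^ 'n" and dt :: real
  assumes offdiag_nonneg: "\<And>i j. i \<noteq> j \<Longrightarrow> 0 \<le> A $ i $ j"
    and conservative: "transpose A *v (\<chi> i. 1) = 0"
    and dt_pos: "0 < dt"
begin

lemma col_sums_0: "(\<Sum>i\<in>UNIV. A $ i $ j) = 0"
proof -
  have "(transpose A *v (\<chi> i. 1)) $ j = (\<Sum>i\<in>UNIV. A $ i $ j)"
    by (simp add: matrix_vector_mult_def transpose_def del: transpose_matrix_vector)
  then show ?thesis
    by (simp add: conservative del: transpose_matrix_vector)
qed

lemma production_matrix_col_sums: "(\<Sum>i\<in>UNIV. production_matrix A u v $ i $ j) = 0"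
  by (simp add: production_matrix_def col_sums_0 del: times_divide_eq_right flip: sum_distrib_right)

lemma destruction_matrix_col_sums: "(\<Sum>i\<in>UNIV. destruction_matrix A u v $ i $ j) = 0"
proof -
  have "(\<Sum>i\<in>UNIV. v $ i * A $ j $ i / u $ j) = (A *v v) $ j / u $ j"
    by (simp add: matrix_vector_mult_def sum_divide_distrib mult_ac)
  then show ?thesis
    by (simp add: destruction_matrix_def sum_subtractf)
qed

lemma mpdec_matrix_col_sums: "(\<Sum>i\<in>UNIV. mpdec_matrix A dt t M m w $ i $ j) = 1"
proof -
  have "(\<Sum>i\<in>UNIV. \<Sum>r=0..M. c r * (G r :: real ^ 'n ^ 'n) $ i $ j) = 0"
    if "\<And>r. (\<Sum>i\<in>UNIV. G r $ i $ j) = 0" for c G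
    by (subst sum.swap) (simp add: that flip: sum_distrib_left)
  then show ?thesis
    by (simp add: mpdec_matrix_def sum_subtractf production_matrix_col_sums
        destruction_matrix_col_sums mat_def)
qed

text \<open>
  A negative quadrature weight multiplies the destruction matrix, whose off-diagonal entries are
  nonpositive, so its contribution to the system matrix has the same sign as that of a positive weight.
\<close>

lemma mpdec_matrix_offdiag:
  assumes "i \<noteq> j" and w: "\<And>r. r \<le> M \<Longrightarrow> w r \<in> pos_orthant" and "m \<le> M"
  shows "mpdec_matrix A dt t M m w $ i $ j \<le> 0"
proof -
  have "0 \<le> theta_pos t M m r * dt * (production_matrix A (w m) (w r) $ i $ j)"
    "0 \<le> theta_neg t M m r * dt * (destruction_matrix A (w m) (w r) $ i $ j)"
    if "r \<in> {0..M}" for r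
  proof -
    have "0 \<le> w r $ k" "0 \<le> w m $ k" for k
      using that w[of r] w[OF \<open>m \<le> M\<close>] by (auto simp: pos_orthant_def less_imp_le)
    then have "0 \<le> production_matrix A (w m) (w r) $ i $ j"
      "destruction_matrix A (w m) (w r) $ i $ j \<le> 0"
      using \<open>i \<noteq> j\<close> offdiag_nonneg[of i j] offdiag_nonneg[of j i]
      by (auto simp: production_matrix_def destruction_matrix_def)
    then show "0 \<le> theta_pos t M m r * dt * (production_matrix A (w m) (w r) $ i $ j)"
      "0 \<le> theta_neg t M m r * dt * (destruction_matrix A (w m) (w r) $ i $ j)"
      using dt_pos theta_pos_nonneg[of t M m r] theta_neg_nonpos[of t M m r]
      by (auto intro!: mult_nonneg_nonneg mult_nonpos_nonpos mult_nonpos_nonneg)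
  qed
  then have "0 \<le> (\<Sum>r=0..M. theta_pos t M m r * dt * (production_matrix A (w m) (w r) $ i $ j))"
    "0 \<le> (\<Sum>r=0..M. theta_neg t M m r * dt * (destruction_matrix A (w m) (w r) $ i $ j))"
    by (blast intro: sum_nonneg)+
  then show ?thesis
    using \<open>i \<noteq> j\<close> by (simp add: mpdec_matrix_def mat_def)
qed

lemma det_mpdec_matrix:
  assumes "\<And>r. r \<le> M \<Longrightarrow> w r \<in> pos_orthant" "m \<le> M"
  shows "det (mpdec_matrix A dt t M m w) \<noteq> 0"
  using assms by (intro det_nonzero_if_col_sums_1 mpdec_matrix_offdiag mpdec_matrix_col_sums)

lemma mpdec_residual_zero:
  assumes yn: "yn \<in> pos_orthant" and w: "\<And>r. r \<le> M \<Longrightarrow> w r \<in> pos_orthant" "m \<le> M"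
  shows "\<exists>!z. mpdec_residual A dt t M m yn w z = 0"
    and "mpdec_residual A dt t M m yn w z = 0 \<Longrightarrow> z \<in> pos_orthant"
proof -
  have res: "mpdec_residual A dt t M m yn w z = 0 \<longleftrightarrow> mpdec_matrix A dt t M m w *v z = yn" for z
    using w by (simp add: mpdec_residual_affine)
  have det: "det (mpdec_matrix A dt t M m w) \<noteq> 0"
    using w by (rule det_mpdec_matrix)
  show "\<exists>!z. mpdec_residual A dt t M m yn w z = 0"
    unfolding res cramer[OF det] by simp
  show "z \<in> pos_orthant" if "mpdec_residual A dt t M m yn w z = 0"
  proof (rule solution_positive_if_col_sums_1)
    show "mpdec_matrix A dt t M m w *v z \<in> pos_orthant"
      using that yn unfolding res by simp
  qed (use w in \<open>auto intro: mpdec_matrix_offdiag mpdec_matrix_col_sums\<close>)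
qed

text \<open>
  Solvability of a stage needs positive data, and positivity of an iterate comes from the system it
  solves; both are therefore carried through the same induction.
\<close>

lemma mpdec_iterates_solve:
  assumes "yn \<in> pos_orthant" "m \<le> M"
  shows "mpdec_iterates A dt t M k yn m \<in> pos_orthant"
    and "m \<noteq> 0 \<Longrightarrow>
      mpdec_residual A dt t M m yn (mpdec_iterates A dt t M k yn) (mpdec_iterates A dt t M (Suc k) yn m) = 0"
proof -
  have *: "mpdec_residual A dt t M m yn (mpdec_iterates A dt t M k yn)
      (mpdec_iterates A dt t M (Suc k) yn m) = 0"
    if "\<And>r. r \<le> M \<Longrightarrow> mpdec_iterates A dt t M k yn r \<in> pos_orthant" "m \<le> M" "m \<noteq> 0" for k m
    using theI'[OF mpdec_residual_zero(1)[OF assms(1) that(1,2)]] that(3) by simp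
  have pos: "mpdec_iterates A dt t M k yn m \<in> pos_orthant" if "m \<le> M" for k m
    using that
  proof (induction k arbitrary: m)
    case 0
    then show ?case
      using assms by simp
  next
    case (Suc k)
    show ?case
    proof (cases "m = 0")
      case False
      show ?thesis
        by (rule mpdec_residual_zero(2)[OF assms(1) Suc.IH Suc.prems *[OF Suc.IH Suc.prems False]])
    qed (use assms in simp)
  qed
  show "mpdec_iterates A dt t M k yn m \<in> pos_orthant"
    using pos assms by blast
  show "mpdec_residual A dt t M m yn (mpdec_iterates A dt t M k yn)
      (mpdec_iterates A dt t M (Suc k) yn m) = 0" if "m \<noteq> 0"
    using * pos assms that by blast
qed

lemma mpdec_iterates_Ck_on:
  assumes "m \<le> M"
  shows "Ck_on n pos_orthant (\<lambda>yn. mpdec_iterates A dt t M k yn m $ i)"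
  using assms
proof (induction k arbitrary: m i)
  case 0
  then show ?case
    using Ck_on_inner[of n pos_orthant "axis i 1"] by (simp add: inner_axis)
next
  case (Suc k)
  show ?case
  proof (cases "m = 0")
    case True
    then show ?thesis
      using Ck_on_inner[of n pos_orthant "axis i 1"] by (simp add: inner_axis)
  next
    case False
    let ?w = "mpdec_iterates A dt t M k"
    have pos: "?w yn r \<in> pos_orthant" if "yn \<in> pos_orthant" "r \<le> M" for yn r
      using mpdec_iterates_solve(1) that by blast
    have nz: "?w yn r $ j \<noteq> 0" if "yn \<in> pos_orthant" "r \<le> M" for yn r j
      using pos[OF that] by (rule pos_orthant_nonzero)
    have "Ck_on n pos_orthant (\<lambda>yn. mpdec_matrix A dt t M m (?w yn) $ i $ j)" for i j
      unfolding mpdec_matrix_def production_matrix_def destruction_matrix_def mat_def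
        matrix_vector_mult_def vector_minus_component sum_component vector_scaleR_component
        vec_lambda_beta real_scaleR_def
      by (intro Ck_on_diff Ck_on_sum Ck_on_mult Ck_on_divide Ck_on_const Ck_on_if Suc.IH nz)
        (use Suc.prems in auto)
    then show ?thesis
    proof (rule Ck_on_Cramer[OF open_pos_orthant])
      show "Ck_on n pos_orthant (\<lambda>yn. yn $ i)" for i
        using Ck_on_inner[of n pos_orthant "axis i 1"] by (simp add: inner_axis)
      show "det (mpdec_matrix A dt t M m (?w yn)) \<noteq> 0" if "yn \<in> pos_orthant" for yn
        using pos that Suc.prems by (intro det_mpdec_matrix) auto
      show "mpdec_matrix A dt t M m (?w yn) *v mpdec_iterates A dt t M (Suc k) yn m = yn"
        if "yn \<in> pos_orthant" for yn
        using mpdec_iterates_solve(2)[OF that Suc.prems False, of t k] pos[OF that Suc.prems]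
        by (simp add: mpdec_residual_affine del: mpdec_iterates.simps)
    qed
  qed
qed

end

section \<open>Derivative of the residual at a steady state\<close>

lemma has_derivative_vecI:
  fixes f :: "'a::real_normed_vector \<Rightarrow> real ^ 'n"
  assumes "\<And>i. ((\<lambda>x. f x $ i) has_derivative (\<lambda>h. f' h $ i)) (at x)"
  shows "(f has_derivative f') (at x)"
  using assms unfolding has_derivative_componentwise_within[of f]
  by (auto simp: Basis_vec_def inner_axis)

lemma jacobianI:
  fixes f :: "real ^ 'n \<Rightarrow> real ^ 'm"
  assumes "(f has_derivative (*v) J) (at x)"
  shows "f differentiable at x" "jacobian f (at x) = J"
  using assms by (auto simp: jacobian_def differentiable_def frechet_derivative_at[OF assms, symmetric])

lemma C2_on_differentiable: "C2_on S f \<Longrightarrow> x \<in> S \<Longrightarrow> f differentiable at x"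
  unfolding C2_on_def differentiable_def by blast

lemma matrix_diff_rdistrib:
  fixes A B :: "real ^ 'n ^ 'm" shows "(A - B) ** C = A ** C - B ** C"
  by (simp add: vec_eq_iff matrix_matrix_mult_def sum_subtractf algebra_simps)

locale mpdec_steady_state = conservative_metzler A dt
  for A :: "real ^ 'n ^ 'n" and dt +
  fixes ystar :: "real ^ 'n" and t :: "nat \<Rightarrow> real" and M :: nat
  assumes ystar_pos: "ystar \<in> pos_orthant" and steady: "A *v ystar = 0"
begin

definition "B = diag ystar ** transpose A ** matrix_inv (diag ystar)"

lemma ystar_nonzero: "ystar $ i \<noteq> 0"
  using ystar_pos by (rule pos_orthant_nonzero)

lemma B_component: "B $ i $ j = ystar $ i * A $ j $ i / ystar $ j"
proof -
  have "(diag ystar ** (transpose A ** diag (\<chi> i. 1 / ystar $ i))) $ i $ j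
      = ystar $ i * A $ j $ i / ystar $ j"
    by (simp add: diag_matrix_mult matrix_mult_diag transpose_def)
  then show ?thesis
    by (simp add: B_def matrix_inv_diag ystar_nonzero matrix_mul_assoc)
qed

lemma production_matrix_steady: "production_matrix A ystar ystar = A"
  by (simp add: production_matrix_def vec_eq_iff ystar_nonzero)

lemma destruction_matrix_steady: "destruction_matrix A ystar ystar = - B"
  by (simp add: destruction_matrix_def vec_eq_iff steady B_component)

text \<open>
  The partial Jacobian of the residual in the vector being solved for; as the residual is
  affine in it, this is the system matrix at the steady state.
\<close>

definition "Phi_jacobian_z m =
  mat 1 - ((\<Sum>r=0..M. theta_pos t M m r) * dt) *\<^sub>R A + ((\<Sum>r=0..M. theta_neg t M m r) * dt) *\<^sub>R B"

lemma mpdec_matrix_steady: "mpdec_matrix A dt t M m (\<lambda>r. ystar) = Phi_jacobian_z m"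
  by (simp add: mpdec_matrix_def production_matrix_steady destruction_matrix_steady
      Phi_jacobian_z_def sum_negf sum_distrib_right flip: scaleR_sum_left)

lemma invertible_Phi_jacobian_z: "m \<le> M \<Longrightarrow> invertible (Phi_jacobian_z m)"
  unfolding invertible_det_nz mpdec_matrix_steady[symmetric]
  by (rule det_mpdec_matrix) (auto intro: ystar_pos)

lemma mpdec_iterates_steady: "m \<le> M \<Longrightarrow> mpdec_iterates A dt t M k ystar m = ystar"
proof (induction k arbitrary: m)
  case (Suc k)
  show ?case
  proof (cases "m = 0")
    case False
    have w: "mpdec_iterates A dt t M k ystar r \<in> pos_orthant" if "r \<le> M" for r
      using that by (simp add: Suc.IH ystar_pos)
    have "mpdec_P A m r (mpdec_iterates A dt t M k ystar) ystar = 0"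
      "mpdec_Q A m r (mpdec_iterates A dt t M k ystar) ystar = 0" if "r \<le> M" for r
      using that Suc.prems w[OF Suc.prems] steady
      by (simp_all add: vec_eq_iff mpdec_P_component mpdec_Q_component Suc.IH ystar_nonzero col_sums_0)
        (simp add: matrix_vector_mult_def)
    then have "mpdec_residual A dt t M m ystar (mpdec_iterates A dt t M k ystar) ystar = 0"
      by (simp add: mpdec_residual_def)
    then show ?thesis
      using mpdec_residual_zero(1)[OF ystar_pos, of M "mpdec_iterates A dt t M k ystar" m t] w Suc.prems
        mpdec_iterates_solve(2)[OF ystar_pos Suc.prems False, of t k] by blast
  qed simp
qed simp

text \<open>
  In this context \<open>W x r\<close> and \<open>Z x\<close> are inserted for the previous correction at node \<open>r\<close> and for the
  unknown. They depend on a parameter and take the steady state as their value at \<open>x\<close>.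
\<close>

context
  fixes W :: "real ^ 'n \<Rightarrow> nat \<Rightarrow> real ^ 'n" and W' :: "nat \<Rightarrow> real ^ 'n \<Rightarrow> real ^ 'n"
    and Z Z' :: "real ^ 'n \<Rightarrow> real ^ 'n" and x :: "real ^ 'n" and m :: nat
  assumes W: "\<And>r. r \<le> M \<Longrightarrow> ((\<lambda>x. W x r) has_derivative W' r) (at x)"
    and W_steady: "\<And>r. r \<le> M \<Longrightarrow> W x r = ystar"
    and Z: "(Z has_derivative Z') (at x)" and Z_steady: "Z x = ystar" and m: "m \<le> M"
begin

lemma W_component: "r \<le> M \<Longrightarrow> ((\<lambda>x. W x r $ i) has_derivative (\<lambda>h. W' r h $ i)) (at x)"
  and Z_component: "((\<lambda>x. Z x $ i) has_derivative (\<lambda>h. Z' h $ i)) (at x)"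
  using W Z by (auto intro: bounded_linear.has_derivative[OF bounded_linear_vec_nth])

lemma has_derivative_quotient:
  "((\<lambda>x. Z x $ j / W x m $ j) has_derivative (\<lambda>h. (Z' h $ j - W' m h $ j) / ystar $ j)) (at x)"
  using ystar_nonzero[of j]
  by (auto intro!: derivative_eq_intros W_component Z_component m
      simp: W_steady Z_steady m fun_eq_iff field_simps)

text \<open>
  At the steady state every quotient \<open>z\<^sub>j / w\<^sub>j\<close> is \<open>1\<close> and its derivative is divided by the same
  \<open>y\<^sup>*\<^sub>j\<close> by which it is then multiplied, so no diagonal matrices survive.
\<close>

lemma has_derivative_mpdec_P:
  assumes "r \<le> M"
  shows "((\<lambda>x. mpdec_P A m r (W x) (Z x)) has_derivative (\<lambda>h. A *v (Z' h + W' r h - W' m h))) (at x)"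
proof (rule has_derivative_vecI)
  fix i
  have "((\<lambda>x. \<Sum>j\<in>UNIV. A $ i $ j * (Z x $ j / W x m $ j * W x r $ j)) has_derivative
      (\<lambda>h. \<Sum>j\<in>UNIV. A $ i $ j * (Z x $ j / W x m $ j * W' r h $ j +
        (Z' h $ j - W' m h $ j) / ystar $ j * W x r $ j))) (at x)"
    by (intro has_derivative_sum has_derivative_mult_right has_derivative_mult
        has_derivative_quotient W_component assms)
  also have "(\<lambda>h. \<Sum>j\<in>UNIV. A $ i $ j * (Z x $ j / W x m $ j * W' r h $ j +
        (Z' h $ j - W' m h $ j) / ystar $ j * W x r $ j)) =
      (\<lambda>h. (A *v (Z' h + W' r h - W' m h)) $ i)"
    using assms m
    by (simp add: fun_eq_iff W_steady Z_steady ystar_nonzero matrix_vector_mult_def add_diff_eq add.commute)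
  finally have *: "((\<lambda>x. \<Sum>j\<in>UNIV. A $ i $ j * (Z x $ j / W x m $ j * W x r $ j)) has_derivative
      (\<lambda>h. (A *v (Z' h + W' r h - W' m h)) $ i)) (at x)" .
  (* The componentwise formula inverts diag (W x m), so it is only available near x. *)
  have "((\<lambda>x. W x m) \<longlongrightarrow> ystar) (at x)"
    using has_derivative_continuous[OF W[OF m]] W_steady[OF m] by (simp add: continuous_at)
  then have "\<forall>\<^sub>F x in at x. W x m \<in> pos_orthant"
    using open_pos_orthant ystar_pos by (rule topological_tendstoD)
  then have "\<forall>\<^sub>F x in at x. (\<Sum>j\<in>UNIV. A $ i $ j * (Z x $ j / W x m $ j * W x r $ j)) =
      mpdec_P A m r (W x) (Z x) $ i"
    by eventually_elim (simp add: mpdec_P_component)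
  then show "((\<lambda>x. mpdec_P A m r (W x) (Z x) $ i) has_derivative
      (\<lambda>h. (A *v (Z' h + W' r h - W' m h)) $ i)) (at x)"
    by (rule has_derivative_transform_eventually[OF *])
      (simp_all add: mpdec_P_component W_steady m ystar_pos)
qed

text \<open>
  Two of the four terms of the product rule vanish because \<open>A y\<^sup>* = 0\<close> and the columns of \<open>A\<close> sum to
  zero. The variation of the quotients in the last sum is what produces \<open>B\<close>.
\<close>

lemma has_derivative_mpdec_Q:
  assumes "r \<le> M"
  shows "((\<lambda>x. mpdec_Q A m r (W x) (Z x)) has_derivative
    (\<lambda>h. A *v W' r h - B *v (Z' h - W' m h))) (at x)"
proof (rule has_derivative_vecI)
  fix i
  let ?U = "\<lambda>x j. Z x $ j / W x m $ j" and ?U' = "\<lambda>h j. (Z' h $ j - W' m h $ j) / ystar $ j"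
  have "((\<lambda>x. mpdec_Q A m r (W x) (Z x) $ i) has_derivative
      (\<lambda>h. (?U x i * (A *v W' r h) $ i + ?U' h i * (A *v W x r) $ i) -
        (W x r $ i * (\<Sum>j\<in>UNIV. A $ j $ i * ?U' h j) +
         W' r h $ i * (\<Sum>j\<in>UNIV. A $ j $ i * ?U x j)))) (at x)"
    unfolding mpdec_Q_component
    by (intro has_derivative_diff has_derivative_mult has_derivative_sum has_derivative_mult_right
        has_derivative_quotient W_component assms
        bounded_linear.has_derivative[OF bounded_linear_vec_nth]
        bounded_linear.has_derivative[OF matrix_vector_mul_bounded_linear] W)
  also have "(\<lambda>h. (?U x i * (A *v W' r h) $ i + ?U' h i * (A *v W x r) $ i) -
        (W x r $ i * (\<Sum>j\<in>UNIV. A $ j $ i * ?U' h j) +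
         W' r h $ i * (\<Sum>j\<in>UNIV. A $ j $ i * ?U x j))) =
      (\<lambda>h. (A *v W' r h - B *v (Z' h - W' m h)) $ i)"
    using assms m
    by (simp add: fun_eq_iff W_steady Z_steady ystar_nonzero steady col_sums_0
        matrix_vector_mult_def[of B] B_component sum_distrib_left mult_ac)
  finally show "((\<lambda>x. mpdec_Q A m r (W x) (Z x) $ i) has_derivative
      (\<lambda>h. (A *v W' r h - B *v (Z' h - W' m h)) $ i)) (at x)" .
qed

end

text \<open>
  The part of the derivative that is due to the Patankar denominators, that is, to the previous
  correction at the current node.
\<close>

definition "Phi_jacobian_w m =
  ((\<Sum>r=0..M. theta_pos t M m r) * dt) *\<^sub>R A - ((\<Sum>r=0..M. theta_neg t M m r) * dt) *\<^sub>R B"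

text \<open>
  The total derivative at the steady state. The splitting of the weights by sign matters only for the
  Patankar quotients; in the quadrature of \<open>A w\<^sub>r\<close> the two parts recombine to the full weight.
\<close>

lemma has_derivative_mpdec_residual:
  fixes x :: "real ^ 'n"
  assumes m: "m \<le> M"
    and Y: "(Y has_derivative (*v) DY) (at x)"
    and W: "\<And>r. r \<le> M \<Longrightarrow> ((\<lambda>x. W x r) has_derivative (*v) (DW r)) (at x)"
    and W_steady: "\<And>r. r \<le> M \<Longrightarrow> W x r = ystar"
    and Z: "(Z has_derivative (*v) DZ) (at x)" and Z_steady: "Z x = ystar"
  shows "((\<lambda>x. mpdec_residual A dt t M m (Y x) (W x) (Z x)) has_derivative
    (*v) (Phi_jacobian_z m ** DZ - DY + Phi_jacobian_w m ** DW m
          - (\<Sum>r=0..M. (theta t M m r * dt) *\<^sub>R (A ** DW r)))) (at x)"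
    (is "(_ has_derivative (*v) ?J) _")
proof -
  have sum_const: "(\<Sum>r=0..M. (c r * dt) *\<^sub>R v) = ((\<Sum>r=0..M. c r) * dt) *\<^sub>R v"
    for c and v :: "real ^ 'n"
    by (simp add: scaleR_sum_left sum_distrib_right)
  have "?J *v h = DZ *v h - DY *v h
      - (\<Sum>r=0..M. (theta_pos t M m r * dt) *\<^sub>R (A *v (DZ *v h + DW r *v h - DW m *v h)))
      - (\<Sum>r=0..M. (theta_neg t M m r * dt) *\<^sub>R (A *v (DW r *v h) - B *v (DZ *v h - DW m *v h)))"
    for h
    by (simp add: Phi_jacobian_z_def Phi_jacobian_w_def matrix_vector_mult_diff_rdistrib
        matrix_vector_mult_add_rdistrib matrix_vector_mult_sum_left
        matrix_vector_mult_diff_distrib matrix_vector_right_distrib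
        sum.distrib sum_subtractf scaleR_right_distrib scaleR_right_diff_distrib
        sum_const scaleR_left_distrib ring_distribs
        flip: matrix_vector_mul_assoc scaleR_matrix_vector_assoc theta_pos_plus_neg)
  then have J: "(*v) ?J = (\<lambda>h. DZ *v h - DY *v h
      - (\<Sum>r=0..M. (theta_pos t M m r * dt) *\<^sub>R (A *v (DZ *v h + DW r *v h - DW m *v h)))
      - (\<Sum>r=0..M. (theta_neg t M m r * dt) *\<^sub>R (A *v (DW r *v h) - B *v (DZ *v h - DW m *v h))))"
    by blast
  show ?thesis
    unfolding mpdec_residual_def J
    by (intro has_derivative_diff has_derivative_sum has_derivative_scaleR_right Y Z
        has_derivative_mpdec_P[where W' = "\<lambda>r. (*v) (DW r)"]
        has_derivative_mpdec_Q[where W' = "\<lambda>r. (*v) (DW r)"] W W_steady Z_steady m) auto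
qed

section \<open>Partial Jacobians and the implicit equation\<close>

lemma has_derivative_id_matrix: "((\<lambda>x. x) has_derivative (*v) (mat 1 :: real ^ 'n ^ 'n)) (at x)"
  and has_derivative_const_matrix: "((\<lambda>x. c) has_derivative (*v) (0 :: real ^ 'n ^ 'n)) (at x)"
  by (simp_all add: fun_eq_iff matrix_vector_mul_lid[abs_def] matrix_vector_mult_0[abs_def])

text \<open>
  In the first correction all iterates of the previous one are \<open>y\<^sup>n\<close>. The positive parts of the
  weights then cancel between the Patankar quotients and the quadrature.
\<close>

lemma Phi_jacobian_k1:
  "Phi_jacobian_w m - mat 1 - (\<Sum>r=0..M. (theta t M m r * dt) *\<^sub>R A) =
   - (mat 1 + (dt * (\<Sum>r=0..M. theta_neg t M m r)) *\<^sub>R (A + B))"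
proof -
  have "(\<Sum>r=0..M. (theta t M m r * dt) *\<^sub>R A) =
      ((\<Sum>r=0..M. theta_pos t M m r) * dt + (\<Sum>r=0..M. theta_neg t M m r) * dt) *\<^sub>R A"
    by (simp add: sum.distrib ring_distribs flip: theta_pos_plus_neg scaleR_sum_left sum_distrib_right)
  then show ?thesis
    by (simp add: Phi_jacobian_w_def scaleR_left_distrib scaleR_right_distrib mult.commute)
qed

lemma Phi_in_yn_jacobian:
  assumes "m \<in> {1..M}" "k \<ge> 1"
  shows "(mpdec_Phi_in_yn A dt t M ystar m k has_derivative
    (*v) (if k = 1 then - (mat 1 + (dt * (\<Sum>r=0..M. theta_neg t M m r)) *\<^sub>R (A + B))
          else - (mat 1 + (theta t M m 0 * dt) *\<^sub>R A))) (at ystar)"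
proof -
  let ?DW = "\<lambda>r. if k = 1 \<or> r = 0 then mat 1 else 0 :: real ^ 'n ^ 'n"
  have "(mpdec_Phi_in_yn A dt t M ystar m k has_derivative
    (*v) (Phi_jacobian_z m ** 0 - mat 1 + Phi_jacobian_w m ** ?DW m
          - (\<Sum>r=0..M. (theta t M m r * dt) *\<^sub>R (A ** ?DW r)))) (at ystar)"
    unfolding mpdec_Phi_in_yn_def[abs_def] mpdec_Phi_def using assms
    by (intro has_derivative_mpdec_residual)
       (auto intro: has_derivative_id_matrix has_derivative_const_matrix)
  also have "Phi_jacobian_z m ** 0 - mat 1 + Phi_jacobian_w m ** ?DW m
          - (\<Sum>r=0..M. (theta t M m r * dt) *\<^sub>R (A ** ?DW r)) =
      (if k = 1 then - (mat 1 + (dt * (\<Sum>r=0..M. theta_neg t M m r)) *\<^sub>R (A + B))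
       else - (mat 1 + (theta t M m 0 * dt) *\<^sub>R A))"
  proof (cases "k = 1")
    case True
    then show ?thesis
      by (simp add: Phi_jacobian_k1)
  next
    case False
    have "(\<Sum>r=0..M. (theta t M m r * dt) *\<^sub>R (A ** ?DW r)) =
        (\<Sum>r=0..M. if r = 0 then (theta t M m 0 * dt) *\<^sub>R A else 0)"
      using False by (intro sum.cong) auto
    then show ?thesis
      using False assms by simp
  qed
  finally show ?thesis .
qed

lemma Phi_in_current_jacobian:
  assumes "m \<in> {1..M}" "k \<ge> 1"
  shows "(mpdec_Phi_in_y A dt t M ystar m k m k has_derivative (*v) (Phi_jacobian_z m)) (at ystar)"
proof -
  have "((\<lambda>x. mpdec_residual A dt t M m ystar (\<lambda>r. ystar) x) has_derivative
    (*v) (Phi_jacobian_z m ** mat 1 - 0 + Phi_jacobian_w m ** 0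
          - (\<Sum>r=0..M. (theta t M m r * dt) *\<^sub>R (A ** 0)))) (at ystar)"
    using assms
    by (intro has_derivative_mpdec_residual has_derivative_id_matrix has_derivative_const_matrix) auto
  moreover have "mpdec_Phi_in_y A dt t M ystar m k m k = mpdec_residual A dt t M m ystar (\<lambda>r. ystar)"
    using assms by (cases k) (auto simp: mpdec_Phi_in_y_def[abs_def] mpdec_Phi_def cong: if_cong)
  ultimately show ?thesis
    by simp
qed

lemma Phi_in_previous_jacobian:
  assumes "m \<in> {1..M}" "k > 1" "l \<in> {1..M}"
  shows "(mpdec_Phi_in_y A dt t M ystar m k l (k - 1) has_derivative
    (*v) ((if l = m then Phi_jacobian_w m else 0) - (theta t M m l * dt) *\<^sub>R A)) (at ystar)"
proof -
  let ?DW = "\<lambda>r. if r = l then mat 1 else 0 :: real ^ 'n ^ 'n"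
  have "((\<lambda>x. mpdec_residual A dt t M m ystar (\<lambda>r. if r = l then x else ystar) ystar) has_derivative
    (*v) (Phi_jacobian_z m ** 0 - 0 + Phi_jacobian_w m ** ?DW m
          - (\<Sum>r=0..M. (theta t M m r * dt) *\<^sub>R (A ** ?DW r)))) (at ystar)"
    using assms
    by (intro has_derivative_mpdec_residual)
       (auto intro: has_derivative_id_matrix has_derivative_const_matrix)
  moreover have "mpdec_Phi_in_y A dt t M ystar m k l (k - 1) =
      (\<lambda>x. mpdec_residual A dt t M m ystar (\<lambda>r. if r = l then x else ystar) ystar)"
    using assms
    by (auto simp: mpdec_Phi_in_y_def[abs_def] mpdec_Phi_def fun_eq_iff
        intro!: arg_cong2[where f = "mpdec_residual A dt t M m ystar"])
  moreover have "(\<Sum>r=0..M. (theta t M m r * dt) *\<^sub>R (A ** ?DW r)) = (theta t M m l * dt) *\<^sub>R A"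
  proof -
    have "(\<Sum>r=0..M. (theta t M m r * dt) *\<^sub>R (A ** ?DW r)) =
        (\<Sum>r=0..M. if r = l then (theta t M m l * dt) *\<^sub>R A else 0)"
      by (rule sum.cong) auto
    then show ?thesis
      using assms by simp
  qed
  ultimately show ?thesis
    by (cases "l = m") simp_all
qed

text \<open>
  The residual along the iterates vanishes on the open positive orthant, so its derivative is zero.
\<close>

lemma implicit_jacobian:
  assumes "m \<in> {1..M}"
    and D: "\<And>r k. r \<le> M \<Longrightarrow>
      ((\<lambda>yn. mpdec_iterates A dt t M k yn r) has_derivative (*v) (D k r)) (at ystar)"
  shows "Phi_jacobian_z m ** D (Suc k) m - mat 1 + Phi_jacobian_w m ** D k m
          - (\<Sum>r=0..M. (theta t M m r * dt) *\<^sub>R (A ** D k r)) = 0" (is "?J = 0")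
proof -
  have "((\<lambda>yn. mpdec_residual A dt t M m yn (mpdec_iterates A dt t M k yn)
      (mpdec_iterates A dt t M (Suc k) yn m)) has_derivative (*v) ?J) (at ystar)"
    using assms(1)
    by (intro has_derivative_mpdec_residual[where W = "mpdec_iterates A dt t M k"]
        has_derivative_id_matrix D mpdec_iterates_steady) auto
  moreover have "mpdec_residual A dt t M m yn (mpdec_iterates A dt t M k yn)
      (mpdec_iterates A dt t M (Suc k) yn m) = 0" if "yn \<in> pos_orthant" for yn
    using assms that by (intro mpdec_iterates_solve(2)) auto
  ultimately have "((\<lambda>yn. 0) has_derivative (*v) ?J) (at ystar)"
    by (rule has_derivative_transform_within_open[OF _ open_pos_orthant ystar_pos])
  then have "(*v) ?J = (*v) 0"
    using has_derivative_const_matrix by (rule has_derivative_unique)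
  then have "matrix ((*v) ?J) = matrix ((*v) (0 :: real ^ 'n ^ 'n))"
    by (rule arg_cong)
  then show ?thesis
    unfolding matrix_of_matrix_vector_mul .
qed

end

section \<open>The Jacobian of the step map\<close>

theorem theorem4p1:
  fixes A B :: "real ^ 'n ^ 'n" and dt :: real and t :: "nat \<Rightarrow> real" and M K :: nat
    and ystar :: "real ^ 'n" and g :: "real ^ 'n \<Rightarrow> real ^ 'n"
    and y :: "nat \<Rightarrow> nat \<Rightarrow> real ^ 'n \<Rightarrow> real ^ 'n"
    and Phi_n :: "nat \<Rightarrow> nat \<Rightarrow> real ^ 'n \<Rightarrow> real ^ 'n"
    and Phi_y :: "nat \<Rightarrow> nat \<Rightarrow> nat \<Rightarrow> nat \<Rightarrow> real ^ 'n \<Rightarrow> real ^ 'n"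
    and Dn_y Dn_Phi :: "nat \<Rightarrow> nat \<Rightarrow> real ^ 'n ^ 'n"
    and D_Phi :: "nat \<Rightarrow> nat \<Rightarrow> nat \<Rightarrow> nat \<Rightarrow> real ^ 'n ^ 'n"
  assumes "A \<noteq> 0"
    and "\<And>i j. i \<noteq> j \<Longrightarrow> 0 \<le> A $ i $ j"
    and "transpose A *v (\<chi> i. 1) = 0"
    and "alg_mult A 0 = geom_mult A 0" and "1 \<le> geom_mult A 0"
    and "\<And>l. complex_eigenvalue A l \<Longrightarrow> Re l \<le> 0"
    and "0 < dt" and "1 \<le> M" and "1 \<le> K"
    and "t 0 = 0" and "t M = 1" and "strict_mono_on {0..M} t"
    and "A *v ystar = 0" and "ystar \<in> pos_orthant"
    and B: "B = diag ystar ** transpose A ** matrix_inv (diag ystar)"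
    and g: "g = mpdec_step A dt t M K"
    and y: "\<And>m k. y m k = (\<lambda>yn. mpdec_iterates A dt t M k yn m)"
    and Phi_n: "\<And>m k. Phi_n m k = mpdec_Phi_in_yn A dt t M ystar m k"
    and Phi_y: "\<And>m k l s. Phi_y m k l s = mpdec_Phi_in_y A dt t M ystar m k l s"
    and Dn_y: "\<And>m k. Dn_y m k = jacobian (y m k) (at ystar)"
    and Dn_Phi: "\<And>m k. Dn_Phi m k = jacobian (Phi_n m k) (at ystar)"
    and D_Phi: "\<And>m k l s. D_Phi m k l s = jacobian (Phi_y m k l s) (at ystar)"
  shows
    "(\<forall>yn\<in>pos_orthant. \<forall>k\<in>{1..K}. \<forall>m\<in>{1..M}.
        (\<exists>!z. mpdec_residual A dt t M m yn (\<lambda>r. y r (k - 1) yn) z = 0) \<and> y m k yn \<in> pos_orthant) \<and>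
     g ` pos_orthant \<subseteq> pos_orthant \<and>
     C2_on pos_orthant g \<and>
     jacobian g (at ystar) = Dn_y M K \<and>
     (\<forall>m\<in>{1..M}. \<forall>k\<in>{1..K}.
        y m k differentiable at ystar \<and>
        Phi_n m k differentiable at ystar \<and>
        Phi_y m k m k differentiable at ystar \<and>
        invertible (D_Phi m k m k) \<and>
        Dn_y m k =
          - (matrix_inv (D_Phi m k m k) **
              (Dn_Phi m k +
               (1 - (if k = 1 then 1 else 0)) *\<^sub>R (\<Sum>r=1..M. D_Phi m k r (k - 1) ** Dn_y r (k - 1)))) \<and>
        Dn_Phi m k =
          (if k = 1 then - (mat 1 + (dt * (\<Sum>r=0..M. theta_neg t M m r)) *\<^sub>R (A + B))
           else - (mat 1 + (theta t M m 0 * dt) *\<^sub>R A)) \<and>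
        (k > 1 \<longrightarrow>
          (\<forall>l\<in>{1..M}.
             Phi_y m k l (k - 1) differentiable at ystar \<and>
             D_Phi m k l (k - 1) =
               (if l \<noteq> m then - ((theta t M m l * dt) *\<^sub>R A)
                else ((\<Sum>r=0..M. theta_pos t M m r) * dt) *\<^sub>R A
                     - ((\<Sum>r=0..M. theta_neg t M m r) * dt) *\<^sub>R B
                     - (theta t M m m * dt) *\<^sub>R A))) \<and>
        D_Phi m k m k =
          mat 1 - ((\<Sum>r=0..M. theta_pos t M m r) * dt) *\<^sub>R A
                + ((\<Sum>r=0..M. theta_neg t M m r) * dt) *\<^sub>R B)"
proof -
  interpret scheme: mpdec_steady_state A dt ystar t M
    using assms by unfold_locales auto
  note jacobian_B = B[folded scheme.B_def]
  have g_eq: "g = y M K"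
    by (simp add: g y mpdec_step_def[abs_def])
  have y_pos: "y m k yn \<in> pos_orthant" if "yn \<in> pos_orthant" "m \<le> M" for m k yn
    unfolding y using that by (rule scheme.mpdec_iterates_solve(1))
  have y_C2: "C2_on pos_orthant (y m k)" if "m \<le> M" for m k
    unfolding y using scheme.mpdec_iterates_Ck_on[OF that] by (rule C2_on_if_Ck_on)
  have y_diff: "y m k differentiable at ystar" if "m \<le> M" for m k
    using y_C2[OF that] scheme.ystar_pos by (rule C2_on_differentiable)
  have Dy: "(y m k has_derivative (*v) (Dn_y m k)) (at ystar)" if "m \<le> M" for m k
    using y_diff[OF that] unfolding Dn_y jacobian_works .
  (* The value at node 0 and the zeroth correction are the initial value itself. *)
  have y_0: "Dn_y 0 k = mat 1" for k
  proof -
    have "y 0 k = (\<lambda>yn. yn)"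
      by (cases k) (simp_all add: y)
    then show ?thesis
      by (simp add: Dn_y jacobianI(2)[OF scheme.has_derivative_id_matrix])
  qed
  have y_init: "Dn_y m 0 = mat 1" for m
    by (simp add: Dn_y y jacobianI(2)[OF scheme.has_derivative_id_matrix])

  have implicit: "D_Phi m k m k ** Dn_y m k +
      (Dn_Phi m k + (1 - (if k = 1 then 1 else 0)) *\<^sub>R (\<Sum>r=1..M. D_Phi m k r (k - 1) ** Dn_y r (k - 1))) = 0"
    if m: "m \<in> {1..M}" and k: "k \<ge> 1" for m k
  proof -
    note Phi_n_jac = jacobianI(2)[OF scheme.Phi_in_yn_jacobian[OF m k]]
    obtain j where j: "k = Suc j"
      using k by (cases k) auto
    have "scheme.Phi_jacobian_z m ** Dn_y m (Suc j) - mat 1 + scheme.Phi_jacobian_w m ** Dn_y m j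
          - (\<Sum>r=0..M. (theta t M m r * dt) *\<^sub>R (A ** Dn_y r j)) = 0"
      using Dy unfolding y by (intro scheme.implicit_jacobian[OF m])
    moreover have "D_Phi m k m k = scheme.Phi_jacobian_z m"
      unfolding D_Phi Phi_y by (rule jacobianI(2)[OF scheme.Phi_in_current_jacobian[OF m k]])
    moreover have "Dn_Phi m k + (1 - (if k = 1 then 1 else 0)) *\<^sub>R
        (\<Sum>r=1..M. D_Phi m k r (k - 1) ** Dn_y r (k - 1)) =
        - mat 1 + scheme.Phi_jacobian_w m ** Dn_y m j
        - (\<Sum>r=0..M. (theta t M m r * dt) *\<^sub>R (A ** Dn_y r j))"
    proof (cases "k = 1")
      case True
      then show ?thesis
        using Phi_n_jac m j
        by (simp add: Dn_Phi Phi_n y_init scheme.Phi_jacobian_k1)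
    next
      case False
      have "D_Phi m k r (k - 1) ** Dn_y r (k - 1) =
          (if r = m then scheme.Phi_jacobian_w m ** Dn_y m j else 0)
          - (theta t M m r * dt) *\<^sub>R (A ** Dn_y r j)" if "r \<in> {1..M}" for r
        using jacobianI(2)[OF scheme.Phi_in_previous_jacobian[OF m _ that, of k]] False k j
        by (simp add: D_Phi Phi_y matrix_diff_rdistrib scalar_matrix_assoc)
      then have "(\<Sum>r=1..M. D_Phi m k r (k - 1) ** Dn_y r (k - 1)) =
          (\<Sum>r=1..M. (if r = m then scheme.Phi_jacobian_w m ** Dn_y m j else 0)
            - (theta t M m r * dt) *\<^sub>R (A ** Dn_y r j))"
        by (rule sum.cong[OF refl])
      also have "\<dots> = scheme.Phi_jacobian_w m ** Dn_y m j
          - (\<Sum>r=1..M. (theta t M m r * dt) *\<^sub>R (A ** Dn_y r j))"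
        using m by (simp add: sum_subtractf)
      (* Node 0 always carries the initial value, so its summand of the quadrature is part of Dn_Phi. *)
      finally show ?thesis
        using Phi_n_jac False
        by (simp add: Dn_Phi Phi_n sum.atLeast_Suc_atMost[of 0 M] y_0)
    qed
    ultimately show ?thesis
      by (simp add: j add_diff_eq diff_add_eq)
  qed

  have wellposed: "\<forall>yn\<in>pos_orthant. \<forall>k\<in>{1..K}. \<forall>m\<in>{1..M}.
      (\<exists>!z. mpdec_residual A dt t M m yn (\<lambda>r. y r (k - 1) yn) z = 0) \<and> y m k yn \<in> pos_orthant"
    by (intro ballI conjI scheme.mpdec_residual_zero(1) y_pos) auto
  have g_pos: "g ` pos_orthant \<subseteq> pos_orthant"
    using y_pos by (auto simp: g_eq)
  have g_C2: "C2_on pos_orthant g"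
    unfolding g_eq by (rule y_C2) simp
  have g_jacobian: "jacobian g (at ystar) = Dn_y M K"
    by (simp add: g_eq Dn_y)
  show ?thesis
  proof (rule conjI[OF wellposed conjI[OF g_pos conjI[OF g_C2 conjI[OF g_jacobian]]]],
      intro ballI conjI impI)
    fix m k
    assume m: "m \<in> {1..M}" and k: "k \<in> {1..K}"
    have k1: "k \<ge> 1"
      using k by simp
    note cur = scheme.Phi_in_current_jacobian[OF m k1]
    note yn = scheme.Phi_in_yn_jacobian[OF m k1]
    have D_cur: "D_Phi m k m k = scheme.Phi_jacobian_z m"
      unfolding D_Phi Phi_y by (rule jacobianI(2)[OF cur])
    show "y m k differentiable at ystar"
      using m y_diff by simp
    show "Phi_n m k differentiable at ystar"
      unfolding Phi_n by (rule jacobianI(1)[OF yn])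
    show "Phi_y m k m k differentiable at ystar"
      unfolding Phi_y by (rule jacobianI(1)[OF cur])
    show inv: "invertible (D_Phi m k m k)"
      unfolding D_cur using m by (intro scheme.invertible_Phi_jacobian_z) simp
    show "Dn_y m k = - (matrix_inv (D_Phi m k m k) ** (Dn_Phi m k +
        (1 - (if k = 1 then 1 else 0)) *\<^sub>R (\<Sum>r=1..M. D_Phi m k r (k - 1) ** Dn_y r (k - 1))))"
      using inv implicit[OF m k1] by (rule solve_linear_matrix_equation)
    show "Dn_Phi m k =
          (if k = 1 then - (mat 1 + (dt * (\<Sum>r=0..M. theta_neg t M m r)) *\<^sub>R (A + B))
           else - (mat 1 + (theta t M m 0 * dt) *\<^sub>R A))"
      unfolding Dn_Phi Phi_n jacobian_B by (rule jacobianI(2)[OF yn])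
    show "D_Phi m k m k =
          mat 1 - ((\<Sum>r=0..M. theta_pos t M m r) * dt) *\<^sub>R A
                + ((\<Sum>r=0..M. theta_neg t M m r) * dt) *\<^sub>R B"
      unfolding D_cur jacobian_B by (rule scheme.Phi_jacobian_z_def)
    fix l assume "1 < k" and l: "l \<in> {1..M}"
    note prev = scheme.Phi_in_previous_jacobian[OF m \<open>1 < k\<close> l]
    show "Phi_y m k l (k - 1) differentiable at ystar"
      unfolding Phi_y by (rule jacobianI(1)[OF prev])
    show "D_Phi m k l (k - 1) =
               (if l \<noteq> m then - ((theta t M m l * dt) *\<^sub>R A)
                else ((\<Sum>r=0..M. theta_pos t M m r) * dt) *\<^sub>R A
                     - ((\<Sum>r=0..M. theta_neg t M m r) * dt) *\<^sub>R B
                     - (theta t M m m * dt) *\<^sub>R A)"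
      unfolding D_Phi Phi_y jacobianI(2)[OF prev] jacobian_B
      by (simp add: scheme.Phi_jacobian_w_def)
  qed
qed

end
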